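(* Let $s\ge 0$ be an even integer. Then the first and last letters of any $u_s$-saturated sequence (on any finite nonempty alphabet) are the same.
   Context: Sequences are finite words over an alphabet; a sequence on a given alphabet takes its letters from that alphabet (not every letter is required to appear). Two sequences are isomorphic if one is obtained from the other by a one-to-one renaming of letters. A sequence contains a copy of $u$ if some (not necessarily contiguous) subsequence of it is isomorphic to $u$; otherwise it is $u$-free. A sequence is $2$-sparse if no two adjacent letters are equal. For an integer $s\ge 0$, $u_s=xyxy\dots$ is the alternating sequence on two distinct letters $x,y$ of length $s+2$. A sequence on a given alphabet is $u_s$-saturated if it is $2$-sparse, $u_s$-free, and inserting any letter of the alphabet at any position (including the beginning or the end) violates $2$-sparsity or creates a copy of $u_s$. *)

theory Defs
  imports Main "HOL-Library.Sublist"
begin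

text \<open>The two words may live over different letter types. The renaming only has to be
  one-to-one on the letters that actually occur.\<close>

definition seq_isomorphic :: "'a list \<Rightarrow> 'b list \<Rightarrow> bool" where
  "seq_isomorphic u v \<longleftrightarrow> (\<exists>f. inj_on f (set u) \<and> v = map f u)"

definition contains_copy :: "'a list \<Rightarrow> 'b list \<Rightarrow> bool" where
  "contains_copy w u \<longleftrightarrow> (\<exists>v. subseq v w \<and> seq_isomorphic u v)"

definition seq_free :: "'b list \<Rightarrow> 'a list \<Rightarrow> bool" where
  "seq_free u w \<longleftrightarrow> \<not> contains_copy w u"

text \<open>The word \<open>xyxy\<dots>\<close> of length \<open>s + 2\<close>, with the concrete letters \<open>x = 0\<close> and \<open>y = 1\<close>.
  The choice of letters is immaterial, since the word is only used up to isomorphism.\<close>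

definition alt_seq :: "nat \<Rightarrow> nat list" where
  "alt_seq s = map (\<lambda>i. i mod 2) [0..<s + 2]"

definition insert_at :: "nat \<Rightarrow> 'a \<Rightarrow> 'a list \<Rightarrow> 'a list" where
  "insert_at p a w = take p w @ a # drop p w"

text \<open>The word \<open>w\<close> on the alphabet \<open>A\<close> need not use every letter of \<open>A\<close>; the inserted
  letters range over all of \<open>A\<close>. The predicate \<^const>\<open>distinct_adj\<close> is 2-sparsity.\<close>

definition alt_saturated :: "nat \<Rightarrow> 'a set \<Rightarrow> 'a list \<Rightarrow> bool" where
  "alt_saturated s A w \<longleftrightarrow>
     set w \<subseteq> A \<and> distinct_adj w \<and> seq_free (alt_seq s) w \<and>
     (\<forall>a\<in>A. \<forall>p\<le>length w.
        \<not> distinct_adj (insert_at p a w) \<or> contains_copy (insert_at p a w) (alt_seq s))"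

end

theory Submission imports Defs begin

text \<open>
  If the first letter \<open>x\<close> and the last letter of \<open>w\<close> differed, appending \<open>x\<close> to \<open>w\<close> would
  keep it 2-sparse, so by saturation it would create an alternation of length \<open>s + 2\<close> whose final
  letter is the new \<open>x\<close>. As \<open>s + 2\<close> is even, this alternation reads \<open>zxzx\<dots>zx\<close> and
  starts with \<open>z \<noteq> x\<close>. Hence it starts after the first letter of \<open>w\<close>, and moving its final
  \<open>x\<close> to the initial \<open>x\<close> of \<open>w\<close> gives \<open>xzxz\<dots>xz\<close>: an alternation of the same length
  inside \<open>w\<close> itself, which is \<open>u\<^sub>s\<close>-free. The parity step is \<open>rotate_alt_seq\<close>.
\<close>

lemma alt_seq_Cons: "alt_seq s = 0 # map (\<lambda>i. i mod 2) [1..<s + 2]"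
  by (simp add: alt_seq_def upt_rec[of 0])

lemma alt_seq_snoc: "alt_seq s = map (\<lambda>i. i mod 2) [0..<s + 1] @ [(s + 1) mod 2]"
  by (simp add: alt_seq_def)

lemma seq_isomorphic_length: "seq_isomorphic u v \<Longrightarrow> length v = length u"
  by (auto simp: seq_isomorphic_def)

text \<open>An alternating word of even length ends with its second letter, so moving the last letter to
  the front yields the alternating word with the two letters exchanged.\<close>

lemma rotate_alt_seq:
  assumes "even s"
  shows "1 # butlast (alt_seq s) = map (\<lambda>i. 1 - i) (alt_seq s)"
proof (rule nth_equalityI)
  fix i assume i: "i < length (1 # butlast (alt_seq s))"
  show "(1 # butlast (alt_seq s)) ! i = map (\<lambda>i. 1 - i) (alt_seq s) ! i"
  proof (cases i)
    case 0
    then show ?thesis by (simp add: alt_seq_Cons)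
  next
    case (Suc j)
    with i have "j < s + 1" by (simp add: alt_seq_def)
    moreover have "j mod 2 = 1 - Suc j mod 2" by presburger
    ultimately show ?thesis
      using Suc by (simp add: alt_seq_def butlast_conv_take take_map nth_append del: upt_Suc)
  qed
qed (simp add: alt_seq_def)

lemma seq_isomorphic_alt_seq_rotate:
  assumes "even s" and "seq_isomorphic (alt_seq s) v"
  shows "seq_isomorphic (alt_seq s) (last v # butlast v)"
proof -
  obtain f where f: "inj_on f (set (alt_seq s))" and v: "v = map f (alt_seq s)"
    using assms(2) by (auto simp: seq_isomorphic_def)
  have letters: "set (alt_seq s) = {0, 1}"
  proof
    show "set (alt_seq s) \<subseteq> {0, 1}" by (auto simp: alt_seq_def)
    have "0 mod 2 \<in> set (alt_seq s)"
      unfolding alt_seq_def set_map by (rule imageI) auto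
    moreover have "1 mod 2 \<in> set (alt_seq s)"
      unfolding alt_seq_def set_map by (rule imageI) auto
    ultimately show "{0, 1} \<subseteq> set (alt_seq s)" by simp
  qed
  have "last (alt_seq s) = 1"
    using \<open>even s\<close> by (simp add: alt_seq_snoc mod2_eq_if)
  moreover have "alt_seq s \<noteq> []" by (simp add: alt_seq_def)
  ultimately have "last v # butlast v = map f (1 # butlast (alt_seq s))"
    using v by (simp add: last_map map_butlast)
  also have "\<dots> = map (f \<circ> (\<lambda>i. 1 - i)) (alt_seq s)"
    using rotate_alt_seq[OF \<open>even s\<close>] by simp
  finally have "last v # butlast v = map (f \<circ> (\<lambda>i. 1 - i)) (alt_seq s)" .
  moreover have "inj_on (f \<circ> (\<lambda>i. 1 - i)) (set (alt_seq s))"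
    using f by (auto simp: letters inj_on_def)
  ultimately show ?thesis by (auto simp: seq_isomorphic_def)
qed

lemma hd_neq_last_alt_copy:
  assumes "even s" and "seq_isomorphic (alt_seq s) v"
  shows "hd v \<noteq> last v"
proof -
  obtain f where f: "inj_on f (set (alt_seq s))" and v: "v = map f (alt_seq s)"
    using assms(2) by (auto simp: seq_isomorphic_def)
  have ne: "alt_seq s \<noteq> []" by (simp add: alt_seq_def)
  have "hd (alt_seq s) = 0" by (simp add: alt_seq_Cons)
  moreover have "last (alt_seq s) = 1"
    using \<open>even s\<close> by (simp add: alt_seq_snoc mod2_eq_if)
  ultimately have "hd (alt_seq s) \<noteq> last (alt_seq s)" by simp
  then have "f (hd (alt_seq s)) \<noteq> f (last (alt_seq s))"
    using f ne by (meson hd_in_set inj_onD last_in_set)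
  then show ?thesis
    using v ne by (simp add: hd_map last_map)
qed

text \<open>A copy of \<open>u\<^sub>s\<close> that uses the appended letter \<open>x\<close> ends with \<open>x\<close>, so it begins with a
  letter other than \<open>x\<close> and misses the initial \<open>x\<close>. This leaves room to move its last letter to
  the front.\<close>

lemma contains_alt_seq_snoc_hd:
  assumes "even s" and "contains_copy (x # w @ [x]) (alt_seq s)"
  shows "contains_copy (x # w) (alt_seq s)"
proof -
  obtain v where sub: "subseq v ((x # w) @ [x])" and iso: "seq_isomorphic (alt_seq s) v"
    using assms(2) by (auto simp: contains_copy_def)
  from sub obtain v1 v2 where v: "v = v1 @ v2" and v1: "subseq v1 (x # w)" and v2: "subseq v2 [x]"
    unfolding subseq_append_iff by blast
  from v2 have "v2 = [] \<or> v2 = [x]"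
    by (cases v2) (auto split: if_splits)
  then show ?thesis
  proof
    assume "v2 = []"
    with v v1 iso show ?thesis by (auto simp: contains_copy_def)
  next
    assume "v2 = [x]"
    with v have last: "last v = x" and butlast: "butlast v = v1" by simp_all
    have "length v \<ge> 2"
      using seq_isomorphic_length[OF iso] by (simp add: alt_seq_def)
    with v \<open>v2 = [x]\<close> obtain y ys where v1_eq: "v1 = y # ys"
      by (cases v1) auto
    with hd_neq_last_alt_copy[OF \<open>even s\<close> iso] last v have "y \<noteq> x" by simp
    with v1 v1_eq have "subseq v1 w" by simp
    then have "subseq (last v # butlast v) (x # w)"
      by (simp add: last butlast)
    then show ?thesis
      using seq_isomorphic_alt_seq_rotate[OF \<open>even s\<close> iso] unfolding contains_copy_def by blast
  qed
qed

lemma not_contains_alt_seq_singleton: "\<not> contains_copy [a] (alt_seq s)"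
  by (auto simp: contains_copy_def alt_seq_def
      dest!: seq_isomorphic_length list_emb_length)

theorem lemma2p10:
  fixes s :: nat and A :: "'a set" and w :: "'a list"
  assumes "even s"
    and "finite A" and "A \<noteq> {}"
    and "alt_saturated s A w"
  shows "w \<noteq> [] \<and> hd w = last w"
proof
  have sparse: "distinct_adj w" and free: "\<not> contains_copy w (alt_seq s)"
    and "set w \<subseteq> A"
    and sat: "\<And>a p. a \<in> A \<Longrightarrow> p \<le> length w \<Longrightarrow> distinct_adj (insert_at p a w)
      \<Longrightarrow> contains_copy (insert_at p a w) (alt_seq s)"
    using assms(4) by (auto simp: alt_saturated_def seq_free_def)
  show nonempty: "w \<noteq> []"
  proof
    assume "w = []"
    obtain a where "a \<in> A" using \<open>A \<noteq> {}\<close> by blast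
    from sat[OF this, of 0] \<open>w = []\<close> have "contains_copy [a] (alt_seq s)"
      by (simp add: insert_at_def)
    then show False by (simp add: not_contains_alt_seq_singleton)
  qed
  then obtain x w' where w: "w = x # w'" by (cases w) auto
  show "hd w = last w"
  proof (rule ccontr)
    assume "hd w \<noteq> last w"
    with sparse nonempty have "distinct_adj (w @ [hd w])"
      by (auto simp: distinct_adj_append_iff)
    with sat[of x "length w"] \<open>set w \<subseteq> A\<close> w have "contains_copy (x # w' @ [x]) (alt_seq s)"
      by (simp add: insert_at_def)
    from contains_alt_seq_snoc_hd[OF \<open>even s\<close> this] free w show False by simp
  qed
qed

end
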